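(* Let $\bar A\in\mathbb{R}^{n\times n}$ and $\bar B\in\mathbb{R}^{n\times m}$ form a controllable pair and let $M$ be the deadbeat horizon, i.e. the smallest positive integer such that the matrix $$\mathcal{P}_M=\begin{bmatrix}\bar A^{M-1}\bar B & \bar A^{M-2}\bar B & \cdots & \bar A\bar B & \bar B\end{bmatrix}\in\mathbb{R}^{n\times Mm}$$ has full rank $n$. Consider the nominal system $x_{k+1}=\bar A x_k+\bar B u_k$ with initial condition $x_0=d_0$. Then there exists a deadbeat (disturbance feedback) policy, consisting of $M$ linear feedback gains $\bar K_0,\bar K_1,\dots,\bar K_{M-1}\in\mathbb{R}^{m\times n}$, such that with the inputs $$\bar u_0=\bar K_0 d_0,\quad \bar u_1=\bar K_1 d_0,\quad\dots,\quad \bar u_{M-1}=\bar K_{M-1}d_0$$ applied as $u_0,\dots,u_{M-1}$, one has $x_M=0$ for any initial condition $d_0\in\mathbb{R}^n$.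
   Context: The gains $\bar K_0,\dots,\bar K_{M-1}$ do not depend on $d_0$. Here $n,m$ are positive integers, $x_k\in\mathbb{R}^n$ is the state and $u_k\in\mathbb{R}^m$ the input. Controllability of $(\bar A,\bar B)$ means that $[\bar B\;\bar A\bar B\;\cdots\;\bar A^{n-1}\bar B]$ has rank $n$, so that $M$ is well defined and $M\le n$. *)

theory Defs
  imports "Jordan_Normal_Form.DL_Rank" Complex_Main
begin

definition hcat :: "nat \<Rightarrow> real mat list \<Rightarrow> real mat" where
  "hcat n Ms = mat_of_cols n (concat (map cols Ms))"

definition ctrb_mat :: "nat \<Rightarrow> real mat \<Rightarrow> real mat \<Rightarrow> real mat" where
  "ctrb_mat n A B = hcat n (map (\<lambda>k. A ^\<^sub>m k * B) [0..<n])"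

definition controllable :: "nat \<Rightarrow> real mat \<Rightarrow> real mat \<Rightarrow> bool" where
  "controllable n A B \<longleftrightarrow> vec_space.rank n (ctrb_mat n A B) = n"

text \<open>The blocks appear in decreasing powers: \<open>[A^(N-1) B, \<dots>, A B, B]\<close>.\<close>

definition P_mat :: "nat \<Rightarrow> real mat \<Rightarrow> real mat \<Rightarrow> nat \<Rightarrow> real mat" where
  "P_mat n A B N = hcat n (map (\<lambda>k. A ^\<^sub>m k * B) (rev [0..<N]))"

definition deadbeat_horizon :: "nat \<Rightarrow> real mat \<Rightarrow> real mat \<Rightarrow> nat" where
  "deadbeat_horizon n A B = (LEAST N. 0 < N \<and> vec_space.rank n (P_mat n A B N) = n)"

primrec state :: "real mat \<Rightarrow> real mat \<Rightarrow> (nat \<Rightarrow> real vec) \<Rightarrow> real vec \<Rightarrow> nat \<Rightarrow> real vec" where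
  "state A B u d 0 = d"
| "state A B u d (Suc k) = A *\<^sub>v state A B u d k + B *\<^sub>v u k"

end

theory Submission
  imports Defs
begin

text \<open>
  The state after \<open>N\<close> steps depends linearly on the pair (input sequence, initial state). Hence the
  states reachable from the origin in \<open>N\<close> steps form a subspace. It contains every column
  \<open>A\<^sup>k B e\<^sub>j\<close> with \<open>k < N\<close> of the matrix \<open>[A\<^sup>N\<^sup>-\<^sup>1 B, \<dots>, B]\<close>: apply the impulse \<open>e\<^sub>j\<close> and let it
  evolve freely for \<open>k\<close> further steps. At the deadbeat horizon \<open>M\<close> these columns span the whole
  space (\<open>rank_P_mat_deadbeat_horizon\<close>, \<open>span_cols_full_rank\<close>), so every state is reachable from the
  origin (\<open>reachable_full\<close>). In particular, the negative of the unforced response to \<open>d\<close> is reachable;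
  superposing the two trajectories drives \<open>d\<close> to \<open>0\<close> (\<open>steer_to_zero\<close>).

  So far the input is some sequence chosen for each \<open>d\<close>. It is made linear in \<open>d\<close> by choosing it
  only for the basis vectors: the \<open>j\<close>-th column of the gain \<open>K\<^sub>k\<close> is the input at time \<open>k\<close> that steers
  \<open>e\<^sub>j\<close> to \<open>0\<close>, and linearity does the rest (\<open>linear_feedback_of_open_loop\<close>).
\<close>

section \<open>Full rank at the deadbeat horizon\<close>

text \<open>A maximal independent set of columns has as many elements as the rank, hence \<open>n\<close> of them; being
  independent in an \<open>n\<close>-dimensional space, it is a basis.\<close>

lemma (in vec_space) span_cols_full_rank:
  assumes "P \<in> carrier_mat n nc" and "rank P = n"
  shows "span (set (cols P)) = carrier_vec n"
proof -
  have cols: "set (cols P) \<subseteq> carrier_vec n"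
    using assms(1) cols_dim by blast
  have "\<exists>U. finite U \<and> maximal U (\<lambda>T. T \<subseteq> set (cols P) \<and> lin_indpt T) \<and> {} \<subseteq> U"
    by (rule maximal_exists_superset[of "set (cols P)"]) (auto simp: lin_dep_def)
  then obtain U where "finite U" and max: "maximal U (\<lambda>T. T \<subseteq> set (cols P) \<and> lin_indpt T)"
    by blast
  from max have U: "U \<subseteq> set (cols P)" "lin_indpt U"
    by (simp_all add: maximal_def)
  have "card U = n"
    using rank_card_indpt[OF assms(1) max] assms(2) by simp
  then have "basis U"
    using dim_li_is_basis[OF fin_dim \<open>finite U\<close>] U cols dim_is_n by auto
  then have "carrier_vec n \<subseteq> span (set (cols P))"
    using span_is_monotone[OF U(1)] by (simp add: basis_def)
  moreover have "span (set (cols P)) \<subseteq> carrier_vec n"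
    using span_is_subset2 cols by auto
  ultimately show ?thesis by blast
qed

lemma set_cols_hcat:
  assumes "\<And>X. X \<in> set Ms \<Longrightarrow> X \<in> carrier_mat n m"
  shows "set (cols (hcat n Ms)) = (\<Union>X\<in>set Ms. set (cols X))"
proof -
  have "set (cols X) \<subseteq> carrier_vec n" if "X \<in> set Ms" for X
    using cols_dim[of X] assms[OF that] by simp
  then have "set (concat (map cols Ms)) \<subseteq> carrier_vec n"
    by auto
  then show ?thesis
    by (simp add: hcat_def)
qed

text \<open>The two matrices have the same blocks in opposite order, and the rank depends only on the set
  of columns.\<close>

lemma rank_P_mat_eq_rank_ctrb_mat:
  assumes "A \<in> carrier_mat n n" and "B \<in> carrier_mat n m"
  shows "vec_space.rank n (P_mat n A B n) = vec_space.rank n (ctrb_mat n A B)"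
proof -
  have "\<And>k. A ^\<^sub>m k * B \<in> carrier_mat n m"
    using assms by (meson mult_carrier_mat pow_carrier_mat)
  then have "set (cols (P_mat n A B n)) = set (cols (ctrb_mat n A B))"
    unfolding P_mat_def ctrb_mat_def
    by (subst (1 2) set_cols_hcat[where m = m]) auto
  then show ?thesis
    by (simp add: vec_space.rank_def)
qed

text \<open>The horizon is defined as a least number, which means something only if a suitable number
  exists; controllability supplies \<open>n\<close> itself.\<close>

lemma rank_P_mat_deadbeat_horizon:
  assumes "0 < n" and "A \<in> carrier_mat n n" and "B \<in> carrier_mat n m"
    and "controllable n A B"
  shows "vec_space.rank n (P_mat n A B (deadbeat_horizon n A B)) = n"
proof -
  have "0 < n \<and> vec_space.rank n (P_mat n A B n) = n"
    using assms rank_P_mat_eq_rank_ctrb_mat by (simp add: controllable_def)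
  then show ?thesis
    unfolding deadbeat_horizon_def by (rule LeastI2) simp
qed

section \<open>Linearity of the state\<close>

lemma mult_mat_vec_zero:
  assumes "X \<in> carrier_mat n k"
  shows "X *\<^sub>v 0\<^sub>v k = 0\<^sub>v n"
  using assms by (intro eq_vecI) auto

text \<open>Matrix powers are defined by multiplication on the right, whereas one time step of the system
  multiplies by \<open>A\<close> on the left.\<close>

lemma pow_mat_Suc_left:
  assumes "X \<in> carrier_mat n n"
  shows "X ^\<^sub>m Suc k = X * X ^\<^sub>m k"
proof (induction k)
  case (Suc k)
  have "X ^\<^sub>m Suc (Suc k) = X * X ^\<^sub>m k * X"
    using Suc by simp
  also have "\<dots> = X * (X ^\<^sub>m k * X)"
    by (rule assoc_mult_mat[OF assms pow_carrier_mat[OF assms] assms])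
  finally show ?case by simp
qed (use assms in simp)

lemma state_cong:
  assumes "\<And>k. k < N \<Longrightarrow> u k = v k"
  shows "state A B u d N = state A B v d N"
  using assms by (induction N) auto

context
  fixes A B :: "real mat" and n m :: nat
  assumes A: "A \<in> carrier_mat n n" and B: "B \<in> carrier_mat n m"
begin

lemma state_carrier:
  assumes "d \<in> carrier_vec n"
  shows "state A B u d N \<in> carrier_vec n"
proof (cases N)
  case (Suc k)
  have "dim_vec (state A B u d (Suc k)) = n"
    using carrier_matD(1)[OF B] by simp
  then show ?thesis
    unfolding Suc by (rule carrier_vecI)
qed (use assms in simp)

lemma state_add:
  assumes "\<And>k. u k \<in> carrier_vec m" "\<And>k. v k \<in> carrier_vec m"
    and "d \<in> carrier_vec n" "e \<in> carrier_vec n"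
  shows "state A B (\<lambda>k. u k + v k) (d + e) N = state A B u d N + state A B v e N"
proof (induction N)
  case (Suc N)
  have "A *\<^sub>v (state A B u d N + state A B v e N) = A *\<^sub>v state A B u d N + A *\<^sub>v state A B v e N"
    by (rule mult_add_distrib_mat_vec[OF A]) (simp_all add: state_carrier assms)
  moreover have "B *\<^sub>v (u N + v N) = B *\<^sub>v u N + B *\<^sub>v v N"
    by (rule mult_add_distrib_mat_vec[OF B]) (simp_all add: assms)
  moreover have "(a + b) + (c + e) = (a + c) + (b + e)"
    if "a \<in> carrier_vec n" "b \<in> carrier_vec n" "c \<in> carrier_vec n" "e \<in> carrier_vec n"
    for a b c e :: "real vec"
    using that by (intro eq_vecI) auto
  ultimately show ?case
    using mult_mat_vec_carrier[OF A state_carrier[OF assms(3), of u N]]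
      mult_mat_vec_carrier[OF A state_carrier[OF assms(4), of v N]]
      mult_mat_vec_carrier[OF B assms(1)[of N]] mult_mat_vec_carrier[OF B assms(2)[of N]]
    by (simp add: Suc del: assoc_add_vec)
qed simp

lemma state_smult:
  assumes "\<And>k. u k \<in> carrier_vec m" and "d \<in> carrier_vec n"
  shows "state A B (\<lambda>k. c \<cdot>\<^sub>v u k) (c \<cdot>\<^sub>v d) N = c \<cdot>\<^sub>v state A B u d N"
proof (induction N)
  case (Suc N)
  have "A *\<^sub>v (c \<cdot>\<^sub>v state A B u d N) = c \<cdot>\<^sub>v (A *\<^sub>v state A B u d N)"
    by (rule mult_mat_vec[OF A]) (simp_all add: state_carrier assms)
  moreover have "B *\<^sub>v (c \<cdot>\<^sub>v u N) = c \<cdot>\<^sub>v (B *\<^sub>v u N)"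
    by (rule mult_mat_vec[OF B]) (simp_all add: assms)
  ultimately show ?case
    using smult_add_distrib_vec[OF mult_mat_vec_carrier[OF A state_carrier[OF assms(2), of u N]]
        mult_mat_vec_carrier[OF B assms(1)[of N]], of c]
    by (simp add: Suc)
qed simp

section \<open>Reachable states\<close>

definition reachable :: "nat \<Rightarrow> real vec set" where
  "reachable N = {state A B u (0\<^sub>v n) N | u. \<forall>k. u k \<in> carrier_vec m}"

lemma reachableI:
  "(\<And>k. u k \<in> carrier_vec m) \<Longrightarrow> x = state A B u (0\<^sub>v n) N \<Longrightarrow> x \<in> reachable N"
  by (auto simp: reachable_def)

lemma zero_in_reachable: "0\<^sub>v n \<in> reachable N"
proof (rule reachableI)
  have "state A B (\<lambda>_. 0\<^sub>v m) (0\<^sub>v n) N = 0\<^sub>v n"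
    by (induction N) (simp_all add: mult_mat_vec_zero[OF A] mult_mat_vec_zero[OF B])
  then show "0\<^sub>v n = state A B (\<lambda>_. 0\<^sub>v m) (0\<^sub>v n) N"
    by simp
qed simp

lemma submodule_reachable: "submodule class_ring (reachable N) (module_vec TYPE(real) n)"
proof -
  interpret vec_space "TYPE(real)" n .
  show ?thesis
  proof (rule submodule.intro)
    fix x y assume "x \<in> reachable N" "y \<in> reachable N"
    then obtain u v where uv: "\<And>k. u k \<in> carrier_vec m" "\<And>k. v k \<in> carrier_vec m"
      and xy: "x = state A B u (0\<^sub>v n) N" "y = state A B v (0\<^sub>v n) N"
      unfolding reachable_def by blast
    have "x + y = state A B (\<lambda>k. u k + v k) (0\<^sub>v n) N"
      using state_add[of u v "0\<^sub>v n" "0\<^sub>v n" N] uv by (simp add: xy)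
    then show "x \<oplus>\<^bsub>module_vec TYPE(real) n\<^esub> y \<in> reachable N"
      using uv by (auto intro!: reachableI[of "\<lambda>k. u k + v k"] simp: module_vec_simps)
  next
    fix c :: real and x assume "x \<in> reachable N"
    then obtain u where u: "\<And>k. u k \<in> carrier_vec m" and x: "x = state A B u (0\<^sub>v n) N"
      unfolding reachable_def by blast
    have "c \<cdot>\<^sub>v x = state A B (\<lambda>k. c \<cdot>\<^sub>v u k) (0\<^sub>v n) N"
      using state_smult[of u "0\<^sub>v n" c N] u by (simp add: x)
    then show "c \<odot>\<^bsub>module_vec TYPE(real) n\<^esub> x \<in> reachable N"
      using u by (auto intro!: reachableI[of "\<lambda>k. c \<cdot>\<^sub>v u k"] simp: module_vec_simps)
  next
    show "reachable N \<subseteq> carrier (module_vec TYPE(real) n)"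
      by (auto simp: reachable_def module_vec_simps state_carrier)
  qed (simp_all add: zero_in_reachable module_vec_simps module_axioms)
qed

lemma reachable_step:
  assumes "x \<in> reachable N" and "w \<in> carrier_vec m"
  shows "A *\<^sub>v x + B *\<^sub>v w \<in> reachable (Suc N)"
proof -
  obtain u where u: "\<And>k. u k \<in> carrier_vec m" and x: "x = state A B u (0\<^sub>v n) N"
    using assms(1) unfolding reachable_def by blast
  have "x = state A B (u(N := w)) (0\<^sub>v n) N"
    unfolding x by (rule state_cong) simp
  then show ?thesis
    using u assms(2) by (auto intro!: reachableI[of "u(N := w)"])
qed

text \<open>The impulse \<open>w\<close> enters through \<open>B\<close> in the last step if \<open>k = 0\<close>; otherwise it enters earlier and
  the last step, with zero input, contributes one more factor \<open>A\<close>.\<close>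

lemma pow_mult_B_reachable:
  assumes "k < N" and "w \<in> carrier_vec m"
  shows "(A ^\<^sub>m k * B) *\<^sub>v w \<in> reachable N"
  using assms(1)
proof (induction N arbitrary: k)
  case (Suc N)
  show ?case
  proof (cases k)
    case 0
    have "A *\<^sub>v 0\<^sub>v n + B *\<^sub>v w \<in> reachable (Suc N)"
      by (rule reachable_step[OF zero_in_reachable assms(2)])
    moreover have "A *\<^sub>v 0\<^sub>v n + B *\<^sub>v w = (A ^\<^sub>m k * B) *\<^sub>v w"
      using A B mult_mat_vec_carrier[OF B assms(2)] by (simp add: 0 mult_mat_vec_zero[OF A])
    ultimately show ?thesis
      by simp
  next
    case (Suc l)
    have "A *\<^sub>v ((A ^\<^sub>m l * B) *\<^sub>v w) + B *\<^sub>v 0\<^sub>v m \<in> reachable (Suc N)"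
      using Suc.IH[of l] Suc.prems Suc by (intro reachable_step) auto
    moreover have "A ^\<^sub>m k * B = A * (A ^\<^sub>m l * B)"
      unfolding Suc pow_mat_Suc_left[OF A]
      by (rule assoc_mult_mat[OF A pow_carrier_mat[OF A] B])
    moreover have "A *\<^sub>v ((A ^\<^sub>m l * B) *\<^sub>v w) = (A * (A ^\<^sub>m l * B)) *\<^sub>v w"
      by (rule assoc_mult_mat_vec[symmetric, OF A mult_carrier_mat[OF pow_carrier_mat[OF A] B] assms(2)])
    moreover have "(A ^\<^sub>m k * B) *\<^sub>v w \<in> carrier_vec n"
      by (rule mult_mat_vec_carrier[OF mult_carrier_mat[OF pow_carrier_mat[OF A] B] assms(2)])
    ultimately show ?thesis
      by (simp add: mult_mat_vec_zero[OF B])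
  qed
qed simp

lemma cols_P_mat_reachable: "set (cols (P_mat n A B N)) \<subseteq> reachable N"
proof
  fix x assume "x \<in> set (cols (P_mat n A B N))"
  moreover have AB: "A ^\<^sub>m k * B \<in> carrier_mat n m" for k
    using A B by (meson mult_carrier_mat pow_carrier_mat)
  ultimately obtain k where k: "k < N" and "x \<in> set (cols (A ^\<^sub>m k * B))"
    unfolding P_mat_def by (subst (asm) set_cols_hcat[where m = m]) auto
  then obtain j where j: "j < m" and x: "x = col (A ^\<^sub>m k * B) j"
    using AB[of k] by (auto simp: cols_def)
  have "x = (A ^\<^sub>m k * B) *\<^sub>v unit_vec m j"
    unfolding x using A B j by (intro eq_vecI) (simp_all add: col_def row_def)
  then show "x \<in> reachable N"
    using pow_mult_B_reachable[OF k] by simp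
qed

lemma reachable_full:
  assumes "vec_space.rank n (P_mat n A B N) = n"
  shows "reachable N = carrier_vec n"
proof -
  interpret vec_space "TYPE(real)" n .
  have "carrier_vec n = span (set (cols (P_mat n A B N)))"
    by (rule span_cols_full_rank[symmetric, OF _ assms]) (auto simp: P_mat_def hcat_def)
  also have "\<dots> \<subseteq> reachable N"
    by (rule span_is_subset[OF cols_P_mat_reachable submodule_reachable])
  finally show ?thesis
    by (auto simp: reachable_def state_carrier)
qed

section \<open>Deadbeat control\<close>

text \<open>The input that produces the negative of the unforced response from the origin cancels that
  response when it is applied from \<open>d\<close>.\<close>

lemma steer_to_zero:
  assumes "reachable N = carrier_vec n" and d: "d \<in> carrier_vec n"
  shows "\<exists>u. (\<forall>k. u k \<in> carrier_vec m) \<and> state A B u d N = 0\<^sub>v n"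
proof -
  define f where "f = state A B (\<lambda>_. 0\<^sub>v m) d N"
  have f: "f \<in> carrier_vec n"
    unfolding f_def by (rule state_carrier[OF d])
  then have "- f \<in> reachable N"
    using assms(1) by simp
  then obtain u where u: "\<And>k. u k \<in> carrier_vec m" and "- f = state A B u (0\<^sub>v n) N"
    unfolding reachable_def by blast
  then have "state A B u d N = f + - f"
    using state_add[of "\<lambda>_. 0\<^sub>v m" u d "0\<^sub>v n" N] d by (simp add: f_def)
  then show ?thesis
    using u f by auto
qed

text \<open>Open-loop inputs that depend on the initial state in an arbitrary way can be replaced by linear
  ones. The \<open>n\<close> trajectories that start at the basis vectors are run side by side, as the columns of
  matrices \<open>S\<^sub>k\<close> with \<open>S\<^sub>0 = 1\<close> and \<open>S\<^sub>k\<^sub>+\<^sub>1 = A S\<^sub>k + B K\<^sub>k\<close>. Multiplying this recursion by \<open>d\<close> gives the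
  trajectory from \<open>d\<close> under the inputs \<open>K\<^sub>k d\<close>, and \<open>S\<^sub>N = 0\<close>.\<close>

lemma linear_feedback_of_open_loop:
  assumes "\<And>d. d \<in> carrier_vec n \<Longrightarrow>
             \<exists>u. (\<forall>k. u k \<in> carrier_vec m) \<and> state A B u d N = 0\<^sub>v n"
  shows "\<exists>K. (\<forall>k. K k \<in> carrier_mat m n) \<and>
           (\<forall>d \<in> carrier_vec n. \<forall>u. (\<forall>k<N. u k = K k *\<^sub>v d) \<longrightarrow> state A B u d N = 0\<^sub>v n)"
proof -
  have "\<forall>j. \<exists>u. (\<forall>k. u k \<in> carrier_vec m) \<and> state A B u (unit_vec n j) N = 0\<^sub>v n"
    using assms by simp
  then obtain U where U: "\<And>j k. U j k \<in> carrier_vec m"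
    and U0: "\<And>j. state A B (U j) (unit_vec n j) N = 0\<^sub>v n"
    by metis
  define K where "K k = mat_of_cols m (map (\<lambda>j. U j k) [0..<n])" for k
  define S where "S k = mat_of_cols n (map (\<lambda>j. state A B (U j) (unit_vec n j) k) [0..<n])" for k
  have K: "K k \<in> carrier_mat m n" and S: "S k \<in> carrier_mat n n" for k
    by (auto simp: K_def S_def)
  have col_K: "col (K k) j = U j k" if "j < n" for j k
    using that U by (simp add: K_def)
  have col_S: "col (S k) j = state A B (U j) (unit_vec n j) k" if "j < n" for j k
    using that by (simp add: S_def state_carrier)
  have S_0: "S 0 = 1\<^sub>m n"
    by (rule mat_col_eqI) (auto simp: col_S S[THEN carrier_matD(1)] S[THEN carrier_matD(2)])
  have S_Suc: "S (Suc k) = A * S k + B * K k" for k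
  proof (rule mat_col_eqI)
    fix j assume "j < dim_col (A * S k + B * K k)"
    then have j: "j < n"
      using K[of k] by simp
    have "col (A * S k + B * K k) j = col (A * S k) j + col (B * K k) j"
      using A B S[of k] K[of k] j by (intro eq_vecI) auto
    also have "\<dots> = A *\<^sub>v col (S k) j + B *\<^sub>v col (K k) j"
      by (simp add: col_mult2[OF A S j] col_mult2[OF B K j])
    finally show "col (S (Suc k)) j = col (A * S k + B * K k) j"
      using j by (simp add: col_S col_K)
  qed (use A B K[of k] S[of "Suc k"] in auto)
  have S_N: "S N = 0\<^sub>m n n"
    by (rule mat_col_eqI) (use S[of N] in \<open>auto simp: col_S U0\<close>)
  have "state A B u d k = S k *\<^sub>v d"
    if d: "d \<in> carrier_vec n" and u: "\<forall>k<N. u k = K k *\<^sub>v d" and "k \<le> N" for u d k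
    using \<open>k \<le> N\<close>
  proof (induction k)
    case 0
    then show ?case
      using d by (simp add: S_0)
  next
    case (Suc k)
    then have "state A B u d (Suc k) = A *\<^sub>v (S k *\<^sub>v d) + B *\<^sub>v (K k *\<^sub>v d)"
      using u by simp
    also have "\<dots> = (A * S k) *\<^sub>v d + (B * K k) *\<^sub>v d"
      using assoc_mult_mat_vec[OF A S d] assoc_mult_mat_vec[OF B K d] by simp
    also have "\<dots> = (A * S k + B * K k) *\<^sub>v d"
      by (rule add_mult_distrib_mat_vec[symmetric, OF mult_carrier_mat[OF A S] mult_carrier_mat[OF B K] d])
    finally show ?case
      by (simp add: S_Suc)
  qed
  moreover have "0\<^sub>m n n *\<^sub>v d = 0\<^sub>v n" if "d \<in> carrier_vec n" for d :: "real vec"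
    using that by (intro eq_vecI) simp_all
  ultimately have "state A B u d N = 0\<^sub>v n"
    if "d \<in> carrier_vec n" and "\<forall>k<N. u k = K k *\<^sub>v d" for u d
    using that S_N by simp
  then show ?thesis
    using K by blast
qed

end

theorem lemma7:
  fixes A B :: "real mat" and n m M :: nat
  assumes "0 < n" and "0 < m"
    and "A \<in> carrier_mat n n" and "B \<in> carrier_mat n m"
    and "controllable n A B"
    and "M = deadbeat_horizon n A B"
  shows "\<exists>K :: nat \<Rightarrow> real mat.
           (\<forall>k<M. K k \<in> carrier_mat m n) \<and>
           (\<forall>d \<in> carrier_vec n. \<forall>u.
              (\<forall>k<M. u k = K k *\<^sub>v d) \<longrightarrow> state A B u d M = 0\<^sub>v n)"
proof -
  have "vec_space.rank n (P_mat n A B M) = n"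
    using rank_P_mat_deadbeat_horizon assms by blast
  from reachable_full[OF assms(3,4) this]
  show ?thesis
    using linear_feedback_of_open_loop[OF assms(3,4), of M] steer_to_zero[OF assms(3,4)]
    by blast
qed

end
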